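(* Let $f$ be a differentiable function with convex domain $\operatorname{dom} f\subseteq\mathbb{E}$ satisfying the Regularity Assumption. For $x,y\in\operatorname{dom} f$ put $\beta_f(x,y)=f(y)-f(x)-\langle\nabla f(x),y-x\rangle$. Then for any $r\in\Gamma$, $r>0$, and any $x,y\in\operatorname{dom} f$, $$|\beta_f(x,y)|\ \le\ \delta_f^+(r)+\tfrac12 L_f(r)\,\|y-x\|^2,$$ where $$\delta_f^+(r)=2\hat\sigma(r)-\hat\mu(r)\ \ge\ 0,\qquad L_f(r)=\frac{2}{r^2}\,\hat\mu(r).$$
   Context: $\mathbb{E}$ is a finite-dimensional real linear space with dual $\mathbb{E}^*$; $\langle g,x\rangle$ is the value of $g\in\mathbb{E}^*$ at $x\in\mathbb{E}$; $\|\cdot\|$ is an arbitrary fixed norm on $\mathbb{E}$. The function $f:\operatorname{dom} f\to\mathbb{R}$ is not necessarily convex; $\nabla f(x)\in\mathbb{E}^*$ is its gradient at $x$. Global Curvature Bound of $f$: $$\hat\mu(t)=\sup_{x,y\in\operatorname{dom} f,\ \alpha\in(0,1)}\Big\{\frac{|\alpha f(x)+(1-\alpha)f(y)-f(\alpha x+(1-\alpha)y)|}{\alpha(1-\alpha)}:\ \|x-y\|\le t\Big\}.$$ Let $D=\operatorname{diam}(\operatorname{dom} f)$; $\Gamma=[0,D]$ if $D<+\infty$ and $\Gamma=[0,+\infty)$ otherwise. Regularity Assumption: $\hat\mu(t)$ is well defined (finite) for all $t\in\Gamma$, and $\lim_{\tau\to+0}\frac1\tau\hat\mu(\tau)=0$.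 For $r\in\Gamma$: $\hat\sigma(r)=\int_0^r\frac1\tau\hat\mu(\tau)\,d\tau$. *)

theory Defs
  imports "HOL-Analysis.Analysis"
begin

text \<open>
  A function with domain \<open>S\<close> is a total function \<open>f\<close> used only on \<open>S\<close>.
  Elements of the dual space are bounded linear functionals \<open>'a \<Rightarrow>\<^sub>L real\<close>; in finite
  dimension these are all linear functionals.
\<close>

definition finite_dimensional :: "'a::real_vector itself \<Rightarrow> bool" where
  "finite_dimensional _ \<longleftrightarrow> (\<exists>B::'a set. finite B \<and> span B = UNIV)"

text \<open>
  \<open>diameter\<close> is a real number and carries no information for unbounded sets, so
  infinite diameter is expressed by \<open>\<not> bounded S\<close>.
\<close>

definition Gamma_dom :: "'a::real_normed_vector set \<Rightarrow> real set" where
  "Gamma_dom S = (if bounded S then {0..diameter S} else {0..})"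

definition curvature_values :: "('a::real_normed_vector \<Rightarrow> real) \<Rightarrow> 'a set \<Rightarrow> real \<Rightarrow> real set" where
  "curvature_values f S t =
    {\<bar>\<alpha> * f x + (1 - \<alpha>) * f y - f (\<alpha> *\<^sub>R x + (1 - \<alpha>) *\<^sub>R y)\<bar> / (\<alpha> * (1 - \<alpha>)) | x y \<alpha>.
      x \<in> S \<and> y \<in> S \<and> 0 < \<alpha> \<and> \<alpha> < 1 \<and> norm (x - y) \<le> t}"

text \<open>The real supremum below is meaningful only when the set is bounded above, that is, when
  the global curvature bound is finite; \<open>regular_curvature\<close> demands this.\<close>

definition curvature_bound :: "('a::real_normed_vector \<Rightarrow> real) \<Rightarrow> 'a set \<Rightarrow> real \<Rightarrow> real" where
  "curvature_bound f S t = Sup (curvature_values f S t)"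

definition regular_curvature :: "('a::real_normed_vector \<Rightarrow> real) \<Rightarrow> 'a set \<Rightarrow> bool" where
  "regular_curvature f S \<longleftrightarrow>
    (\<forall>t\<in>Gamma_dom S. bdd_above (curvature_values f S t)) \<and>
    ((\<lambda>\<tau>. 1 / \<tau> * curvature_bound f S \<tau>) \<longlongrightarrow> 0) (at_right 0)"

definition curvature_integral :: "('a::real_normed_vector \<Rightarrow> real) \<Rightarrow> 'a set \<Rightarrow> real \<Rightarrow> real" where
  "curvature_integral f S r = integral {0..r} (\<lambda>\<tau>. 1 / \<tau> * curvature_bound f S \<tau>)"

text \<open>
  Derivatives are taken within \<open>S\<close>, which agrees with the usual notion at interior points.
  If \<open>S\<close> has empty interior the gradient need not be unique; \<open>g\<close> is then any choice.
\<close>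

definition is_gradient_on ::
  "('a::real_normed_vector \<Rightarrow> real) \<Rightarrow> ('a \<Rightarrow> 'a \<Rightarrow>\<^sub>L real) \<Rightarrow> 'a set \<Rightarrow> bool" where
  "is_gradient_on f g S \<longleftrightarrow> (\<forall>x\<in>S. (f has_derivative blinfun_apply (g x)) (at x within S))"

definition bregman ::
  "('a::real_normed_vector \<Rightarrow> real) \<Rightarrow> ('a \<Rightarrow> 'a \<Rightarrow>\<^sub>L real) \<Rightarrow> 'a \<Rightarrow> 'a \<Rightarrow> real" where
  "bregman f g x y = f y - f x - blinfun_apply (g x) (y - x)"

definition delta_plus :: "('a::real_normed_vector \<Rightarrow> real) \<Rightarrow> 'a set \<Rightarrow> real \<Rightarrow> real" where
  "delta_plus f S r = 2 * curvature_integral f S r - curvature_bound f S r"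

definition L_const :: "('a::real_normed_vector \<Rightarrow> real) \<Rightarrow> 'a set \<Rightarrow> real \<Rightarrow> real" where
  "L_const f S r = 2 / r\<^sup>2 * curvature_bound f S r"

end

theory Submission
  imports Defs
begin

text \<open>
  Write \<open>\<mu>\<close> for the global curvature bound and \<open>\<sigma>(r)\<close> for the integral of \<open>\<mu>(\<tau>)/\<tau>\<close> over
  \<open>[0,r]\<close>. Two facts about \<open>f\<close> carry the proof; the rest is calculus in one variable.

  The first is that \<open>\<bar>\<beta>(x,y)\<bar> \<le> \<mu>(\<parallel>y - x\<parallel>)\<close>: the gap between \<open>f\<close> and its chord at
  \<open>x + \<alpha>(y - x)\<close>, divided by \<open>\<alpha>(1 - \<alpha>)\<close>, tends to \<open>\<beta>(x,y)\<close> as \<open>\<alpha> \<rightarrow> 0\<close>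
  (\<open>bregman_le_curvature_bound\<close>).

  The second is that \<open>\<mu>(t)/t\<^sup>2\<close> is nonincreasing in \<open>t\<close>
  (\<open>curvature_bound_over_square_antimono\<close>): a bound on chord gaps over segments of one length
  controls longer segments at the quadratic rate. One may think of a martingale on a segment of
  length \<open>t\<close> that starts at an interior point and jumps to one of the two ends of a subsegment of
  length \<open>s\<close> around it, until it is absorbed at an end of the long segment. A jump with variance
  \<open>v\<close> changes the expectation of \<open>f\<close> by at most \<open>v \<mu>(s)/s\<^sup>2\<close>, and the expected variances add up to
  \<open>\<alpha>(1 - \<alpha>)t\<^sup>2\<close>. When \<open>s > t/2\<close>, the two subsegments that share an end with the long one
  suffice, and the argument becomes a pair of linear inequalities (\<open>chord_gap_extend\<close>); smaller
  ratios follow by iteration.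

  Now \<open>\<mu>(\<tau>)/\<tau> \<ge> \<tau> \<mu>(r)/r\<^sup>2\<close> for \<open>\<tau> \<le> r\<close>, and integrating from \<open>d\<close> to \<open>r\<close> gives
  \<open>2\<sigma>(r) \<ge> 2\<sigma>(d) + \<mu>(r)(1 - d\<^sup>2/r\<^sup>2)\<close>. With \<open>d = 0\<close> this reads \<open>2\<sigma>(r) \<ge> \<mu>(r)\<close>, which is
  \<open>\<delta>\<^sup>+ \<ge> 0\<close>. For \<open>d = \<parallel>y - x\<parallel> \<le> r\<close>, the same inequality at \<open>d\<close> bounds \<open>\<mu>(d)\<close> by
  \<open>2\<sigma>(d)\<close>, hence by \<open>2\<sigma>(r) - \<mu>(r) + \<mu>(r) d\<^sup>2/r\<^sup>2\<close>, which is the claimed right-hand side.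
  For \<open>d > r\<close>, \<open>\<mu>(d) \<le> \<mu>(r) d\<^sup>2/r\<^sup>2\<close>, and \<open>\<delta>\<^sup>+ \<ge> 0\<close> finishes the proof.
\<close>

section \<open>Extending a chord estimate to a longer segment\<close>

text \<open>
  Here \<open>\<psi>\<close> stands for a function on \<open>[0,1]\<close> minus its chord, so it vanishes at both ends; the
  hypotheses are its chord estimates on \<open>[0,\<kappa>]\<close> and \<open>[1-\<kappa>,1]\<close> with those zero values already
  inserted. As \<open>\<kappa> > 1/2\<close>, each of the inner end points \<open>1-\<kappa>\<close> and \<open>\<kappa>\<close> lies in the segment that
  ends at the other one. So each of the two unknown values is bounded by a proper fraction
  of the other plus an error, and both can be solved for. The constants fit exactly:
  \<open>K w (1-\<kappa>) + K w (\<kappa>-w) = K w (1-w)\<close>.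
\<close>

lemma chord_gap_extend:
  fixes \<psi> :: "real \<Rightarrow> real"
  assumes lam: "1/2 < \<kappa>" "\<kappa> < 1"
    and left: "\<And>w. 0 \<le> w \<Longrightarrow> w \<le> \<kappa> \<Longrightarrow> \<bar>w / \<kappa> * \<psi> \<kappa> - \<psi> w\<bar> \<le> K * w * (\<kappa> - w)"
    and right: "\<And>w. 1 - \<kappa> \<le> w \<Longrightarrow> w \<le> 1 \<Longrightarrow>
      \<bar>(1 - w) / \<kappa> * \<psi> (1 - \<kappa>) - \<psi> w\<bar> \<le> K * (1 - w) * (w - (1 - \<kappa>))"
    and w: "0 \<le> w" "w \<le> 1"
  shows "\<bar>\<psi> w\<bar> \<le> K * w * (1 - w)"
proof -
  define p where "p = 1 - \<kappa>"
  define q where "q = p / \<kappa>"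
  have p: "0 < p" "p < \<kappa>" "\<kappa> > 0" using lam by (auto simp: p_def)
  have q: "0 < q" "q < 1" "q * \<kappa> = p" using p by (auto simp: q_def)
  define A where "A = max \<bar>\<psi> p\<bar> \<bar>\<psi> \<kappa>\<bar>"
  have A: "\<bar>\<psi> p\<bar> \<le> A" "\<bar>\<psi> \<kappa>\<bar> \<le> A" by (auto simp: A_def)
  have qA: "\<bar>q * \<psi> \<kappa>\<bar> \<le> q * A" "\<bar>q * \<psi> p\<bar> \<le> q * A"
    using A q by (simp_all add: abs_mult mult_left_mono)
  have "\<bar>q * \<psi> \<kappa> - \<psi> p\<bar> \<le> K * p * (\<kappa> - p)"
    using left[of p] p by (simp add: q_def)
  moreover have "\<bar>q * \<psi> p - \<psi> \<kappa>\<bar> \<le> K * p * (\<kappa> - p)"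
    using right[of \<kappa>] p lam by (simp add: q_def p_def)
  ultimately have "A \<le> q * A + K * p * (\<kappa> - p)"
    using qA unfolding A_def by linarith
  moreover have "K * p * (\<kappa> - p) = (K * p * \<kappa>) * (1 - q)"
    unfolding q(3)[symmetric] by (simp add: algebra_simps)
  ultimately have "A * (1 - q) \<le> (K * p * \<kappa>) * (1 - q)"
    by (simp only: right_diff_distrib mult.commute mult_1_right)
  then have AK: "A \<le> K * p * \<kappa>"
    using q by (metis diff_gt_0_iff_gt mult_le_cancel_right_pos)
  \<comment> \<open>The part of a chord that comes from its inner end; its outer end has value zero.\<close>
  have contrib: "\<bar>v / \<kappa> * b\<bar> \<le> K * p * v" if "\<bar>b\<bar> \<le> A" "0 \<le> v" for v b
  proof -
    have "\<bar>v / \<kappa> * b\<bar> = v / \<kappa> * \<bar>b\<bar>" using that p by (simp add: abs_mult)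
    also have "\<dots> \<le> v / \<kappa> * (K * p * \<kappa>)"
      using that AK p by (intro mult_left_mono) auto
    finally show ?thesis using p by (simp add: mult_ac)
  qed
  have triangle: "\<bar>b\<bar> \<le> B + C" if "\<bar>a\<bar> \<le> B" "\<bar>a - b\<bar> \<le> C" for a b B C :: real
    using that by linarith
  show ?thesis
  proof (cases "w \<le> \<kappa>")
    case True
    have "\<bar>\<psi> w\<bar> \<le> K * p * w + K * w * (\<kappa> - w)"
      using contrib[OF A(2) w(1)] left[OF w(1) True] by (rule triangle)
    also have "\<dots> = K * w * (1 - w)" by (simp add: p_def algebra_simps)
    finally show ?thesis .
  next
    case False
    then have "p \<le> w" using p by linarith
    then have chord: "\<bar>(1 - w) / \<kappa> * \<psi> p - \<psi> w\<bar> \<le> K * (1 - w) * (w - p)"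
      using right[of w] w by (simp add: p_def)
    have "\<bar>(1 - w) / \<kappa> * \<psi> p\<bar> \<le> K * p * (1 - w)"
      using contrib[OF A(1), of "1 - w"] w by simp
    then have "\<bar>\<psi> w\<bar> \<le> K * p * (1 - w) + K * (1 - w) * (w - p)"
      using chord by (rule triangle)
    also have "\<dots> = K * w * (1 - w)" by (simp add: algebra_simps)
    finally show ?thesis .
  qed
qed

section \<open>Elementary properties of the curvature bound\<close>

lemma Gamma_dom_downward:
  assumes "t \<in> Gamma_dom S" "0 \<le> s" "s \<le> t"
  shows "s \<in> Gamma_dom S"
  using assms by (auto simp: Gamma_dom_def split: if_splits)

lemma norm_diff_in_Gamma_dom:
  assumes "x \<in> S" "y \<in> S"
  shows "norm (x - y) \<in> Gamma_dom S"
  using assms diameter_bounded_bound[of S x y] by (auto simp: Gamma_dom_def dist_norm)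

text \<open>
  Multiplying out the quotient makes the estimate available at \<open>\<alpha> = 0\<close> and \<open>\<alpha> = 1\<close> too, so that
  points of a subdivided segment need no case distinction.
\<close>

lemma chord_gap_le_curvature_bound:
  assumes "bdd_above (curvature_values f S t)"
    and "x \<in> S" "y \<in> S" "norm (x - y) \<le> t" "0 \<le> \<alpha>" "\<alpha> \<le> 1"
  shows "\<bar>\<alpha> * f x + (1 - \<alpha>) * f y - f (\<alpha> *\<^sub>R x + (1 - \<alpha>) *\<^sub>R y)\<bar>
    \<le> \<alpha> * (1 - \<alpha>) * curvature_bound f S t"
proof (cases "0 < \<alpha> \<and> \<alpha> < 1")
  case True
  then have "\<bar>\<alpha> * f x + (1 - \<alpha>) * f y - f (\<alpha> *\<^sub>R x + (1 - \<alpha>) *\<^sub>R y)\<bar> / (\<alpha> * (1 - \<alpha>))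
    \<le> curvature_bound f S t"
    unfolding curvature_bound_def using assms
    by (intro cSup_upper) (auto simp: curvature_values_def)
  then show ?thesis using True by (simp add: divide_le_eq mult_ac)
next
  case False
  then have "\<alpha> = 0 \<or> \<alpha> = 1" using assms by linarith
  then show ?thesis by auto
qed

text \<open>
  The value of a degenerate segment. It keeps the suprema away from the empty set, where a real
  supremum is unspecified.
\<close>

lemma zero_in_curvature_values:
  assumes "x \<in> S" "0 \<le> t"
  shows "0 \<in> curvature_values f S t"
  unfolding curvature_values_def using assms
  by (intro CollectI exI[of _ x] exI[of _ "1/2"]) (auto simp flip: scaleR_left_distrib)

lemma curvature_bound_mono:
  assumes "x \<in> S" "0 \<le> s" "s \<le> t" "bdd_above (curvature_values f S t)"
  shows "curvature_bound f S s \<le> curvature_bound f S t"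
  unfolding curvature_bound_def
proof (rule cSup_subset_mono)
  show "curvature_values f S s \<noteq> {}" using zero_in_curvature_values assms by fastforce
  show "curvature_values f S s \<subseteq> curvature_values f S t"
    using assms(3) unfolding curvature_values_def by fastforce
qed (use assms in auto)

lemma curvature_bound_nonneg:
  assumes "x \<in> S" "0 \<le> t" "bdd_above (curvature_values f S t)"
  shows "0 \<le> curvature_bound f S t"
  unfolding curvature_bound_def using assms zero_in_curvature_values by (intro cSup_upper)

section \<open>Quadratic scaling of the curvature bound\<close>

text \<open>
  A segment of length at most \<open>t\<close> contains, at either end, a subsegment that is shorter by
  the factor \<open>\<kappa>\<close> and so has chord gaps controlled by \<open>\<mu>(\<kappa>t)\<close>. Subtracting the chord of the
  long segment changes no gap and gives \<open>chord_gap_extend\<close> its normalised function.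
\<close>

lemma curvature_bound_contract:
  fixes S :: "'a::real_normed_vector set"
  assumes "convex S" "x0 \<in> S" "0 \<le> t" "1/2 < \<kappa>" "\<kappa> < 1"
    and bdd: "bdd_above (curvature_values f S (\<kappa> * t))"
  shows "\<kappa>\<^sup>2 * curvature_bound f S t \<le> curvature_bound f S (\<kappa> * t)"
proof -
  define M where "M = curvature_bound f S (\<kappa> * t)"
  define K where "K = M / \<kappa>\<^sup>2"
  have lam: "\<kappa> > 0" using assms by simp
  have "curvature_bound f S t \<le> K"
    unfolding curvature_bound_def
  proof (rule cSup_least)
    show "curvature_values f S t \<noteq> {}"
      using zero_in_curvature_values assms by fastforce
    fix c assume "c \<in> curvature_values f S t"
    then obtain x y \<alpha> where xy: "x \<in> S" "y \<in> S" "0 < \<alpha>" "\<alpha> < 1" "norm (x - y) \<le> t"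
      and c: "c = \<bar>\<alpha> * f x + (1 - \<alpha>) * f y - f (\<alpha> *\<^sub>R x + (1 - \<alpha>) *\<^sub>R y)\<bar> / (\<alpha> * (1 - \<alpha>))"
      unfolding curvature_values_def by blast
    define P where "P w = w *\<^sub>R x + (1 - w) *\<^sub>R y" for w :: real
    define \<psi> where "\<psi> w = f (P w) - (w * f x + (1 - w) * f y)" for w
    have PS: "P w \<in> S" if "0 \<le> w" "w \<le> 1" for w
      unfolding P_def using that xy assms(1) by (intro convexD) auto
    have Pdiff: "P v - P u = (v - u) *\<^sub>R (x - y)" for u v
      by (simp add: P_def algebra_simps)
    have gap: "\<bar>\<theta> * \<psi> v + (1 - \<theta>) * \<psi> u - \<psi> w\<bar> \<le> \<theta> * (1 - \<theta>) * M"
      if "0 \<le> u" "u \<le> 1" "0 \<le> v" "v \<le> 1" "\<bar>v - u\<bar> = \<kappa>" "0 \<le> \<theta>" "\<theta> \<le> 1"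
        "w = \<theta> * v + (1 - \<theta>) * u" for u v w \<theta>
    proof -
      have "norm (P v - P u) \<le> \<kappa> * t"
        using that xy lam unfolding Pdiff by (simp add: mult_left_mono)
      then have "\<bar>\<theta> * f (P v) + (1 - \<theta>) * f (P u) - f (\<theta> *\<^sub>R P v + (1 - \<theta>) *\<^sub>R P u)\<bar>
          \<le> \<theta> * (1 - \<theta>) * M"
        unfolding M_def using that PS bdd by (intro chord_gap_le_curvature_bound) auto
      moreover have "\<theta> *\<^sub>R P v + (1 - \<theta>) *\<^sub>R P u = P w"
        unfolding P_def that(8) by (simp add: algebra_simps)
      moreover have "\<theta> * \<psi> v + (1 - \<theta>) * \<psi> u - \<psi> w
          = \<theta> * f (P v) + (1 - \<theta>) * f (P u) - f (P w)"
        unfolding \<psi>_def that(8) by (simp add: algebra_simps)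
      ultimately show ?thesis by simp
    qed
    have \<psi>01: "\<psi> 0 = 0" "\<psi> 1 = 0" by (simp_all add: \<psi>_def P_def)
    \<comment> \<open>Translates the gap bound \<open>\<theta> (1 - \<theta>) M\<close> at the fraction \<open>\<theta> = v/\<kappa>\<close> of a subsegment into
      the parameter \<open>v\<close> of the whole segment.\<close>
    have parab: "v / \<kappa> * (1 - v / \<kappa>) * M = K * v * (\<kappa> - v)" for v
      using lam unfolding K_def by (simp add: field_simps power2_eq_square)
    have "\<bar>\<psi> \<alpha>\<bar> \<le> K * \<alpha> * (1 - \<alpha>)"
    proof (rule chord_gap_extend[OF assms(4,5)])
      fix w assume "0 \<le> w" "w \<le> \<kappa>"
      then show "\<bar>w / \<kappa> * \<psi> \<kappa> - \<psi> w\<bar> \<le> K * w * (\<kappa> - w)"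
        using gap[of 0 \<kappa> "w / \<kappa>" w] lam assms(5) parab[of w] \<psi>01 by simp
    next
      fix w assume w: "1 - \<kappa> \<le> w" "w \<le> 1"
      have "w = (1 - w) / \<kappa> * (1 - \<kappa>) + (1 - (1 - w) / \<kappa>) * 1"
        using lam by (simp add: field_simps)
      then show "\<bar>(1 - w) / \<kappa> * \<psi> (1 - \<kappa>) - \<psi> w\<bar> \<le> K * (1 - w) * (w - (1 - \<kappa>))"
        using gap[of 1 "1 - \<kappa>" "(1 - w) / \<kappa>" w] lam assms(5) parab[of "1 - w"] \<psi>01 w
        by (simp add: algebra_simps)
    qed (use xy in auto)
    moreover have "\<bar>\<psi> \<alpha>\<bar> = \<bar>\<alpha> * f x + (1 - \<alpha>) * f y - f (\<alpha> *\<^sub>R x + (1 - \<alpha>) *\<^sub>R y)\<bar>"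
      unfolding \<psi>_def P_def by (rule abs_minus_commute)
    ultimately show "c \<le> K"
      unfolding c using xy by (simp add: divide_le_eq mult_ac)
  qed
  then show ?thesis
    using lam unfolding K_def M_def by (simp add: le_divide_eq mult_ac)
qed

text \<open>
  One contraction reaches only ratios above \<open>1/2\<close>. Going from \<open>s\<close> to \<open>t\<close> in steps by the factor
  \<open>3/2\<close>, the last one cut off at \<open>t\<close>, keeps every ratio of neighbours at least \<open>2/3\<close>.
\<close>

lemma curvature_bound_over_square_antimono:
  fixes S :: "'a::real_normed_vector set"
  assumes "convex S" "x0 \<in> S"
    and bdd: "bdd_above (curvature_values f S t)"
    and s: "0 < s" "s \<le> t"
  shows "curvature_bound f S t / t\<^sup>2 \<le> curvature_bound f S s / s\<^sup>2"
proof -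
  have step: "curvature_bound f S v / v\<^sup>2 \<le> curvature_bound f S u / u\<^sup>2"
    if "0 < u" "v / 2 < u" "u \<le> v" "v \<le> t" for u v
  proof (cases "u = v")
    case False
    define \<kappa> where "\<kappa> = u / v"
    have v: "v > 0" and lam: "1/2 < \<kappa>" "\<kappa> < 1" "\<kappa> * v = u"
      using that False by (auto simp: \<kappa>_def field_simps)
    have "curvature_values f S u \<subseteq> curvature_values f S t"
      using that unfolding curvature_values_def by fastforce
    then have "bdd_above (curvature_values f S (\<kappa> * v))"
      using bdd bdd_above_mono lam(3) by metis
    then have "\<kappa>\<^sup>2 * curvature_bound f S v \<le> curvature_bound f S u"
      using curvature_bound_contract[OF assms(1,2), of v \<kappa> f] lam v by simp
    then show ?thesis
      using that v unfolding \<kappa>_def by (simp add: field_simps power2_eq_square)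
  qed simp
  have "curvature_bound f S t / t\<^sup>2 \<le> curvature_bound f S s / s\<^sup>2"
    if "t * (2/3) ^ n \<le> s" "0 < s" "s \<le> t" for n :: nat and s
    using that
  proof (induction n arbitrary: s)
    case 0
    then show ?case by simp
  next
    case (Suc n)
    define u where "u = min t (s * (3/2))"
    have "t * (2/3) ^ n \<le> s * (3/2)" using Suc.prems(1) by simp
    moreover have "t * (2/3) ^ n \<le> t"
      using Suc.prems by (simp add: mult_left_le power_le_one)
    ultimately have "curvature_bound f S t / t\<^sup>2 \<le> curvature_bound f S u / u\<^sup>2"
      using Suc.prems by (intro Suc.IH) (auto simp: u_def)
    also have "\<dots> \<le> curvature_bound f S s / s\<^sup>2"
      using Suc.prems by (intro step) (auto simp: u_def)
    finally show ?case .
  qed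
  moreover obtain n where "(2/3) ^ n < s / t"
    using real_arch_pow_inv[of "s / t" "2/3"] s by auto
  then have "t * (2/3) ^ n \<le> s"
    using s by (simp add: field_simps)
  ultimately show ?thesis using s by blast
qed

section \<open>The Bregman distance as a limit of chord gaps\<close>

text \<open>
  Divided by \<open>\<alpha>\<close>, the chord gap at \<open>x + \<alpha>(y-x)\<close> is \<open>f y - f x\<close> minus a difference quotient of
  \<open>f\<close> at \<open>x\<close> in the direction \<open>y - x\<close>, and is at most \<open>(1 - \<alpha>) \<mu>(\<parallel>y-x\<parallel>)\<close>.
  The segment lies in the convex set \<open>S\<close>, so a derivative within \<open>S\<close> determines
  the limit of the quotient as \<open>\<alpha> \<rightarrow> 0\<close>.
\<close>

lemma bregman_le_curvature_bound:
  fixes S :: "'a::real_normed_vector set"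
  assumes "convex S" "is_gradient_on f g S" "x \<in> S" "y \<in> S"
    and bdd: "bdd_above (curvature_values f S (norm (y - x)))"
  shows "\<bar>bregman f g x y\<bar> \<le> curvature_bound f S (norm (y - x))"
proof -
  define M where "M = curvature_bound f S (norm (y - x))"
  define h where "h \<alpha> = f (x + \<alpha> *\<^sub>R (y - x))" for \<alpha> :: real
  have sub: "(\<lambda>\<alpha>. x + \<alpha> *\<^sub>R (y - x)) ` {0..1} \<subseteq> S"
  proof clarsimp
    fix \<alpha> :: real assume "0 \<le> \<alpha>" "\<alpha> \<le> 1"
    then have "(1 - \<alpha>) *\<^sub>R x + \<alpha> *\<^sub>R y \<in> S" using assms by (intro convexD) auto
    then show "x + \<alpha> *\<^sub>R (y - x) \<in> S" by (simp add: algebra_simps)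
  qed
  have "(f has_derivative blinfun_apply (g x)) (at (x + 0 *\<^sub>R (y - x)) within S)"
    using assms by (simp add: is_gradient_on_def)
  then have "(f has_derivative blinfun_apply (g x))
      (at (x + 0 *\<^sub>R (y - x)) within (\<lambda>\<alpha>. x + \<alpha> *\<^sub>R (y - x)) ` {0..1})"
    using sub by (rule has_derivative_subset)
  moreover have "((\<lambda>\<alpha>. x + \<alpha> *\<^sub>R (y - x)) has_derivative (\<lambda>\<alpha>. \<alpha> *\<^sub>R (y - x))) (at 0 within {0..1})"
    by (auto intro!: derivative_eq_intros)
  ultimately have "(h has_derivative (\<lambda>\<alpha>. blinfun_apply (g x) (\<alpha> *\<^sub>R (y - x)))) (at 0 within {0..1})"
    unfolding h_def by (rule has_derivative_in_compose[rotated])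
  then have "(h has_real_derivative blinfun_apply (g x) (y - x)) (at 0 within {0..1})"
    by (simp add: has_field_derivative_def blinfun.scaleR_right mult_commute_abs)
  then have "((\<lambda>\<alpha>. (h \<alpha> - f x) / \<alpha>) \<longlongrightarrow> blinfun_apply (g x) (y - x)) (at_right 0)"
    by (simp add: has_field_derivative_iff h_def at_within_Icc_at_right)
  then have lim: "((\<lambda>\<alpha>. \<bar>f y - f x - (h \<alpha> - f x) / \<alpha>\<bar>) \<longlongrightarrow> \<bar>bregman f g x y\<bar>) (at_right 0)"
    unfolding bregman_def by (intro tendsto_intros)
  have bound: "\<bar>f y - f x - (h \<alpha> - f x) / \<alpha>\<bar> \<le> (1 - \<alpha>) * M" if "0 < \<alpha>" "\<alpha> < 1" for \<alpha>
  proof -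
    have "\<bar>\<alpha> * f y + (1 - \<alpha>) * f x - f (\<alpha> *\<^sub>R y + (1 - \<alpha>) *\<^sub>R x)\<bar> \<le> \<alpha> * (1 - \<alpha>) * M"
      unfolding M_def using that assms by (intro chord_gap_le_curvature_bound) auto
    moreover have "\<alpha> *\<^sub>R y + (1 - \<alpha>) *\<^sub>R x = x + \<alpha> *\<^sub>R (y - x)"
      by (simp add: algebra_simps)
    moreover have "\<alpha> * f y + (1 - \<alpha>) * f x - h \<alpha> = \<alpha> * (f y - f x - (h \<alpha> - f x) / \<alpha>)"
      using that by (simp add: field_simps)
    ultimately have "\<alpha> * \<bar>f y - f x - (h \<alpha> - f x) / \<alpha>\<bar> \<le> \<alpha> * ((1 - \<alpha>) * M)"
      using that by (simp add: h_def abs_mult mult.assoc)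
    then show ?thesis using that by simp
  qed
  have "((\<lambda>\<alpha>. (1 - \<alpha>) * M) \<longlongrightarrow> (1 - 0) * M) (at_right (0::real))"
    by (intro tendsto_intros)
  moreover have "\<forall>\<^sub>F \<alpha> in at_right 0. \<bar>f y - f x - (h \<alpha> - f x) / \<alpha>\<bar> \<le> (1 - \<alpha>) * M"
    using bound unfolding eventually_at_right_field by (intro exI[of _ 1]) auto
  ultimately have "\<bar>bregman f g x y\<bar> \<le> (1 - 0) * M"
    using lim by (intro tendsto_le[OF _ _ lim]) auto
  then show ?thesis by (simp add: M_def)
qed

section \<open>Integrating the curvature bound\<close>

text \<open>
  Monotonicity makes \<open>m(t)/t\<close> measurable. It is bounded: near \<open>0\<close> by the limit, and away from
  \<open>0\<close> because \<open>m\<close> is at most \<open>m(r)\<close>. At \<open>t = 0\<close> the value is \<open>0\<close>, by division by zero.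
\<close>

lemma integrable_on_over_identity:
  fixes m :: "real \<Rightarrow> real"
  assumes mono: "mono_on {0..r} m"
    and nonneg: "\<And>t. t \<in> {0..r} \<Longrightarrow> 0 \<le> m t"
    and lim: "((\<lambda>t. 1 / t * m t) \<longlongrightarrow> 0) (at_right 0)"
  shows "(\<lambda>t. 1 / t * m t) integrable_on {0..r}"
proof -
  have "\<forall>\<^sub>F t in at_right 0. 1 / t * m t < 1"
    using lim by (rule order_tendstoD) simp
  then obtain \<epsilon> where eps: "\<epsilon> > 0" "\<And>t. 0 < t \<Longrightarrow> t < \<epsilon> \<Longrightarrow> 1 / t * m t < 1"
    unfolding eventually_at_right_field by auto
  define B where "B = max 1 (m r / \<epsilon>)"
  show ?thesis
  proof (rule measurable_bounded_by_integrable_imp_integrable)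
    have "m \<in> borel_measurable (restrict_space borel {0..r})"
      using mono by (rule borel_measurable_mono_on_fnc)
    then have "(\<lambda>t. 1 / t * m t) \<in> borel_measurable (restrict_space borel {0..r})"
      by (intro borel_measurable_times) (auto intro!: measurable_restrict_space1)
    then have "(\<lambda>t. indicator {0..r} t *\<^sub>R (1 / t * m t)) \<in> borel_measurable lborel"
      by (subst (asm) borel_measurable_restrict_space_iff) auto
    then have "(\<lambda>t. indicator {0..r} t *\<^sub>R (1 / t * m t)) \<in> borel_measurable lebesgue"
      by (rule measurable_completion)
    then show "(\<lambda>t. 1 / t * m t) \<in> borel_measurable (lebesgue_on {0..r})"
      by (subst borel_measurable_restrict_space_iff) auto
    show "(\<lambda>_. B) integrable_on {0..r}" by (rule integrable_const_ivl)
    fix t assume t: "t \<in> {0..r}"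
    have "1 / t * m t \<le> B"
    proof (cases "t < \<epsilon>")
      case True
      then have "1 / t * m t \<le> 1"
        using eps(2)[of t] t by (cases "t = 0") (auto intro: less_imp_le)
      then show ?thesis by (simp add: B_def le_max_iff_disj)
    next
      case False
      have m_le: "m t \<le> m r" using mono t by (auto simp: mono_on_def)
      have "m t / t \<le> m r / \<epsilon>"
        using False eps t nonneg[of r] m_le by (intro frac_le) auto
      then show ?thesis by (simp add: B_def)
    qed
    then show "norm (1 / t * m t) \<le> B" using nonneg[OF t] t by simp
  qed auto
qed

text \<open>
  On \<open>[d,r]\<close> the integrand lies above the line \<open>t m(r)/r\<^sup>2\<close>, whose integral is
  \<open>m(r)(1 - d\<^sup>2/r\<^sup>2)/2\<close>. Equality holds for \<open>m(t) = c t\<^sup>2\<close>, the curvature bound of a quadratic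
  form.
\<close>

lemma integral_growth_of_square_antimono:
  fixes m :: "real \<Rightarrow> real"
  assumes int: "(\<lambda>t. 1 / t * m t) integrable_on {0..r}"
    and anti: "\<And>t. 0 < t \<Longrightarrow> t \<le> r \<Longrightarrow> m r / r\<^sup>2 \<le> m t / t\<^sup>2"
    and d: "0 \<le> d" "d \<le> r" and "0 < r"
  shows "2 * integral {0..d} (\<lambda>t. 1 / t * m t) + m r * (1 - d\<^sup>2 / r\<^sup>2)
    \<le> 2 * integral {0..r} (\<lambda>t. 1 / t * m t)"
proof -
  have "((\<lambda>t. c * t) has_integral c * (r\<^sup>2 / 2) - c * (d\<^sup>2 / 2)) {d..r}" for c
    by (intro fundamental_theorem_of_calculus d)
      (auto intro!: derivative_eq_intros DERIV_cmult simp flip: has_real_derivative_iff_has_vector_derivative)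
  moreover have "m r / r\<^sup>2 * (r\<^sup>2 / 2) - m r / r\<^sup>2 * (d\<^sup>2 / 2) = m r * (1 - d\<^sup>2 / r\<^sup>2) / 2"
    using \<open>0 < r\<close> by (simp add: field_simps)
  ultimately have lin: "((\<lambda>t. m r / r\<^sup>2 * t) has_integral m r * (1 - d\<^sup>2 / r\<^sup>2) / 2) {d..r}"
    by metis
  have "m r * (1 - d\<^sup>2 / r\<^sup>2) / 2 \<le> integral {d..r} (\<lambda>t. 1 / t * m t)"
  proof (rule has_integral_le[OF lin])
    show "((\<lambda>t. 1 / t * m t) has_integral integral {d..r} (\<lambda>t. 1 / t * m t)) {d..r}"
      using int d integrable_on_subinterval[of _ "{0..r}" d r]
      by (auto intro!: integrable_integral)
    fix t assume t: "t \<in> {d..r}"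
    show "m r / r\<^sup>2 * t \<le> 1 / t * m t"
    proof (cases "t = 0")
      case False
      then have "m r / r\<^sup>2 * t \<le> m t / t\<^sup>2 * t"
        using anti[of t] t d by (intro mult_right_mono) auto
      then show ?thesis using False by (simp add: power2_eq_square)
    qed simp
  qed
  moreover have "integral {0..d} (\<lambda>t. 1 / t * m t) + integral {d..r} (\<lambda>t. 1 / t * m t)
      = integral {0..r} (\<lambda>t. 1 / t * m t)"
    using d int by (intro Henstock_Kurzweil_Integration.integral_combine) auto
  moreover have "2 * j + a \<le> 2 * k" if "a / 2 \<le> i" "j + i = k" for a i j k :: real
    using that by linarith
  ultimately show ?thesis by blast
qed

section \<open>The inexact quadratic bound\<close>

theorem theorem1:
  fixes f :: "'a::real_normed_vector \<Rightarrow> real"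
    and grad :: "'a \<Rightarrow> 'a \<Rightarrow>\<^sub>L real"
    and S :: "'a set"
    and r :: real
  assumes "finite_dimensional TYPE('a)"
    and "convex S"
    and "is_gradient_on f grad S"
    and "regular_curvature f S"
    and "r \<in> Gamma_dom S"
    and "r > 0"
  shows "delta_plus f S r \<ge> 0 \<and>
    (\<forall>x\<in>S. \<forall>y\<in>S. \<bar>bregman f grad x y\<bar> \<le> delta_plus f S r + 1 / 2 * L_const f S r * (norm (y - x))\<^sup>2)"
proof -
  define \<mu> where "\<mu> = curvature_bound f S"
  define \<sigma> where "\<sigma> s = integral {0..s} (\<lambda>\<tau>. 1 / \<tau> * \<mu> \<tau>)" for s
  have delta: "delta_plus f S r = 2 * \<sigma> r - \<mu> r"
    by (simp add: delta_plus_def curvature_integral_def \<sigma>_def \<mu>_def)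
  \<comment> \<open>The empty set has diameter \<open>0\<close>, which excludes \<open>r > 0\<close>.\<close>
  have "S \<noteq> {}" using assms(5,6) by (auto simp: Gamma_dom_def)
  then obtain x0 where x0: "x0 \<in> S" by auto
  have bdd: "bdd_above (curvature_values f S t)" if "t \<in> Gamma_dom S" for t
    using assms(4) that by (simp add: regular_curvature_def)
  have anti: "\<mu> t / t\<^sup>2 \<le> \<mu> s / s\<^sup>2" if "0 < s" "s \<le> t" "t \<in> Gamma_dom S" for s t
    unfolding \<mu>_def using curvature_bound_over_square_antimono[OF assms(2) x0 bdd] that by blast
  have int: "(\<lambda>\<tau>. 1 / \<tau> * \<mu> \<tau>) integrable_on {0..s}" if "s \<in> Gamma_dom S" for s
  proof (rule integrable_on_over_identity)
    show "mono_on {0..s} \<mu>"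
      unfolding \<mu>_def using curvature_bound_mono[OF x0] bdd Gamma_dom_downward[OF that]
      by (auto simp: mono_on_def)
    show "0 \<le> \<mu> t" if "t \<in> {0..s}" for t
      unfolding \<mu>_def using curvature_bound_nonneg[OF x0] bdd that
        Gamma_dom_downward[OF \<open>s \<in> Gamma_dom S\<close>] by auto
    show "((\<lambda>t. 1 / t * \<mu> t) \<longlongrightarrow> 0) (at_right 0)"
      using assms(4) by (simp add: regular_curvature_def \<mu>_def)
  qed
  have growth: "2 * \<sigma> d + \<mu> s * (1 - d\<^sup>2 / s\<^sup>2) \<le> 2 * \<sigma> s"
    if "0 \<le> d" "d \<le> s" "0 < s" "s \<in> Gamma_dom S" for d s
    unfolding \<sigma>_def using that int anti by (intro integral_growth_of_square_antimono) auto
  have mu_le: "\<mu> s \<le> 2 * \<sigma> s" if "0 < s" "s \<in> Gamma_dom S" for s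
    using growth[of 0 s] that by (simp add: \<sigma>_def)
  have delta_nonneg: "0 \<le> delta_plus f S r" using mu_le assms(5,6) delta by simp
  have "\<bar>bregman f grad x y\<bar> \<le> delta_plus f S r + 1 / 2 * L_const f S r * (norm (y - x))\<^sup>2"
    if xy: "x \<in> S" "y \<in> S" for x y
  proof -
    define d where "d = norm (y - x)"
    have dG: "d \<in> Gamma_dom S" unfolding d_def using xy by (intro norm_diff_in_Gamma_dom)
    have L: "1 / 2 * L_const f S r * d\<^sup>2 = \<mu> r * (d\<^sup>2 / r\<^sup>2)"
      by (simp add: L_const_def \<mu>_def)
    have breg: "\<bar>bregman f grad x y\<bar> \<le> \<mu> d"
      unfolding \<mu>_def d_def using assms(2,3) xy bdd[OF dG[unfolded d_def]]
      by (rule bregman_le_curvature_bound)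
    have "\<bar>bregman f grad x y\<bar> \<le> delta_plus f S r + \<mu> r * (d\<^sup>2 / r\<^sup>2)"
    proof (cases "x = y")
      case True
      then show ?thesis using delta_nonneg by (simp add: bregman_def d_def blinfun.zero_right)
    next
      case False
      then have d: "d > 0" by (simp add: d_def)
      show ?thesis
      proof (cases "d \<le> r")
        case True
        have "\<mu> d \<le> 2 * \<sigma> d" using mu_le d dG by blast
        moreover have "2 * \<sigma> d + \<mu> r * (1 - d\<^sup>2 / r\<^sup>2) \<le> 2 * \<sigma> r"
          using growth True d assms(5,6) by simp
        ultimately show ?thesis using breg delta by (simp add: algebra_simps)
      next
        case False
        have "\<mu> d / d\<^sup>2 \<le> \<mu> r / r\<^sup>2" using anti[of r d] False assms(6) dG by simp
        then have "\<mu> d \<le> \<mu> r * (d\<^sup>2 / r\<^sup>2)" using d by (simp add: field_simps)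
        then show ?thesis using breg delta_nonneg by linarith
      qed
    qed
    then show ?thesis using L by (simp add: d_def)
  qed
  then show ?thesis using delta_nonneg by blast
qed

end
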